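(* For every permutation $\pi$ and every $n\in\mathbb{N}$, the number of $\pi$-avoiding $n\times n$ binary matrices with exactly $n$ 1-entries is at most $(240\,c_\pi^2)^n$.
   Context: A permutation of length $k$ is a sequence $\pi_1,\dots,\pi_k$ containing each element of $[k]$ once; its permutation matrix is the $k\times k$ 0/1 matrix with 1s exactly at positions (column $i$, row $\pi_i$). A binary matrix $M$ contains a binary matrix $P$ if $P$ can be obtained from $M$ by deleting rows and columns and changing an arbitrary subset of 1-entries to $0$; $M$ avoids $\pi$ if it does not contain the permutation matrix of $\pi$. $\mathrm{ex}_\pi(n)$ is the maximum number of 1-entries in a $\pi$-avoiding $n\times n$ binary matrix, and $c_\pi=\lim_{n\to\infty}\mathrm{ex}_\pi(n)/n$ is the Füredi–Hajnal limit (this limit exists). *)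

theory Defs
  imports
    Complex_Main
    "HOL-Combinatorics.Multiset_Permutations"
    "Jordan_Normal_Form.DL_Submatrix"
begin

text \<open>
  A binary matrix is a \<^typ>\<open>bool mat\<close>, with \<^const>\<open>True\<close> for 1 and \<^const>\<open>False\<close> for 0.
  Matrix indices are (row, column) pairs and start at 0, whereas a permutation of length \<open>k\<close> is
  a list with entries \<open>1, \<dots>, k\<close>.
\<close>

definition is_permutation :: "nat list \<Rightarrow> bool" where
  "is_permutation \<pi> \<longleftrightarrow> \<pi> \<in> permutations_of_set {1..length \<pi>}"

definition perm_matrix :: "nat list \<Rightarrow> bool mat" where
  "perm_matrix \<pi> = mat (length \<pi>) (length \<pi>) (\<lambda>(row, col). \<pi> ! col = row + 1)"

text \<open>
  The sets \<open>I\<close> and \<open>J\<close> are the rows and columns that are not deleted; the final implication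
  allows 1-entries, but not 0-entries, of the remaining matrix to be changed.
\<close>

definition mat_contains :: "bool mat \<Rightarrow> bool mat \<Rightarrow> bool" where
  "mat_contains M P \<longleftrightarrow>
     (\<exists>I J. dim_row (submatrix M I J) = dim_row P \<and> dim_col (submatrix M I J) = dim_col P \<and>
        (\<forall>i < dim_row P. \<forall>j < dim_col P. P $$ (i, j) \<longrightarrow> submatrix M I J $$ (i, j)))"

definition avoids :: "bool mat \<Rightarrow> nat list \<Rightarrow> bool" where
  "avoids M \<pi> \<longleftrightarrow> \<not> mat_contains M (perm_matrix \<pi>)"

definition num_ones :: "bool mat \<Rightarrow> nat" where
  "num_ones M = card {(i, j). i < dim_row M \<and> j < dim_col M \<and> M $$ (i, j)}"

text \<open>
  Every matrix contains the permutation matrix of the empty permutation, so \<open>ex_perm [] n\<close> is the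
  maximum of an empty set and has no meaning; for \<open>\<pi> \<noteq> []\<close> the zero matrix avoids \<open>\<pi>\<close>.
\<close>

definition ex_perm :: "nat list \<Rightarrow> nat \<Rightarrow> nat" where
  "ex_perm \<pi> n = Max (num_ones ` {M \<in> carrier_mat n n. avoids M \<pi>})"

definition fh_limit :: "nat list \<Rightarrow> real" where
  "fh_limit \<pi> = lim (\<lambda>n. real (ex_perm \<pi> n) / real n)"

end

theory Submission
  imports Defs
begin

text \<open>
  A direct sum or a skew sum of two avoiders is again an avoider, because a permutation cannot be
  both directly and skew decomposable. So the extremal function is superadditive, and by the
  Marcus--Tardos theorem it is linearly bounded; hence \<open>c\<close> exists and an avoider of size
  \<open>m\<close> has at most \<open>c m\<close> ones.

  Contracting square blocks to single entries preserves avoidance. Contracting 2 by 2 blocks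
  repeatedly shows that there are at most \<open>15 ^ (c m)\<close> avoiders of size \<open>m\<close> when \<open>m\<close> is a power
  of two. An avoider with \<open>n\<close> ones is determined by its contraction to size \<open>m\<close>, about
  \<open>n / c\<close>, and by the choice of its ones among the positions in the nonempty blocks.
\<close>

section \<open>Patterns in sets of positions, and block contraction\<close>

lemma ex_strict_mono_on_into:
  fixes S :: "nat set"
  assumes "finite S" "k \<le> card S"
  obtains r where "strict_mono_on {..<k} r" "r ` {..<k} \<subseteq> S"
proof
  show "strict_mono_on {..<k} ((!) (sorted_list_of_set S))"
    using assms by (intro strict_mono_onI)
      (simp add: sorted_wrt_nth_less[OF strict_sorted_list_of_set])
  show "(!) (sorted_list_of_set S) ` {..<k} \<subseteq> S"
    using assms nth_mem[of _ "sorted_list_of_set S"] by auto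
qed

text \<open>A matrix is represented by the set of its 1-positions. \<open>\<rho>\<close> sends each
  column of the pattern to its row, counted from 0, and \<open>r\<close> and \<open>s\<close>
  enumerate the rows and columns that are kept. Changing further ones to zeros is implicit, since
  only membership in \<open>A\<close> is demanded.\<close>

definition pattern_in :: "nat \<Rightarrow> (nat \<Rightarrow> nat) \<Rightarrow> (nat \<times> nat) set \<Rightarrow> bool" where
  "pattern_in k \<rho> A \<longleftrightarrow> (\<exists>r s. strict_mono_on {..<k} r \<and> strict_mono_on {..<k} s \<and>
     (\<forall>j<k. (r (\<rho> j), s j) \<in> A))"

definition avoiders :: "nat \<Rightarrow> (nat \<Rightarrow> nat) \<Rightarrow> nat \<Rightarrow> (nat \<times> nat) set set" where
  "avoiders k \<rho> n = {A. A \<subseteq> {..<n} \<times> {..<n} \<and> \<not> pattern_in k \<rho> A}"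

definition ex_pattern :: "nat \<Rightarrow> (nat \<Rightarrow> nat) \<Rightarrow> nat \<Rightarrow> nat" where
  "ex_pattern k \<rho> n = Max (card ` avoiders k \<rho> n)"

text \<open>The image of a set of positions under \<open>block_of q\<close> is its contraction: a
  block becomes a 1 exactly when it contains a 1.\<close>

definition block_of :: "nat \<Rightarrow> nat \<times> nat \<Rightarrow> nat \<times> nat" where
  "block_of q = (\<lambda>(x, y). (x div q, y div q))"

lemma finite_avoiders [simp]: "finite (avoiders k \<rho> n)"
  by (rule finite_subset[of _ "Pow ({..<n} \<times> {..<n})"]) (auto simp: avoiders_def)

lemma card_le_ex_pattern: "A \<in> avoiders k \<rho> n \<Longrightarrow> card A \<le> ex_pattern k \<rho> n"
  unfolding ex_pattern_def by (intro Max_ge) auto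

lemma mono_ident: "mono (\<lambda>x::nat. x)"
  by (rule monoI)

lemma mono_div: "mono (\<lambda>x::nat. x div q)"
  by (intro monoI div_le_mono)

lemma block_subset:
  assumes "q > 0"
  shows "{z. block_of q z = (a, b)} \<subseteq> {q * a..<q * a + q} \<times> {q * b..<q * b + q}"
  using assms by (auto simp: block_of_def dividend_less_times_div add.commute[of _ q])

lemma card_block_le:
  assumes "q > 0"
  shows "card {z \<in> A. block_of q z = b} \<le> q\<^sup>2"
proof -
  obtain i j where b: "b = (i, j)" by (cases b)
  have "{z \<in> A. block_of q z = b} \<subseteq> {q * i..<q * i + q} \<times> {q * j..<q * j + q}"
    using block_subset[OF assms] b by blast
  from card_mono[OF _ this] show ?thesis by (simp add: power2_eq_square)
qed

text \<open>\<open>\<gamma>\<close> is the inverse of \<open>\<rho>\<close>, so that transposing the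
  pattern just swaps the two parameters. With \<open>2 \<le> k\<close> a single 1-entry avoids the
  pattern, which later gives \<open>1 \<le> c\<close>.\<close>

locale perm_pattern =
  fixes k :: nat and \<rho> \<gamma> :: "nat \<Rightarrow> nat"
  assumes k_ge_2: "2 \<le> k"
    and row_less: "j < k \<Longrightarrow> \<rho> j < k" and col_less: "i < k \<Longrightarrow> \<gamma> i < k"
    and col_row: "j < k \<Longrightarrow> \<gamma> (\<rho> j) = j" and row_col: "i < k \<Longrightarrow> \<rho> (\<gamma> i) = i"
begin

lemma transpose: "perm_pattern k \<gamma> \<rho>"
  using k_ge_2 row_less col_less col_row row_col by unfold_locales auto

text \<open>Transposing a matrix inverts the permutation; this carries statements about block
  columns over to block rows.\<close>

lemma pattern_in_converse: "pattern_in k \<gamma> (A\<inverse>) \<longleftrightarrow> pattern_in k \<rho> A"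
proof
  assume "pattern_in k \<gamma> (A\<inverse>)"
  then obtain r s where "strict_mono_on {..<k} r" "strict_mono_on {..<k} s"
    "\<forall>j<k. (s j, r (\<gamma> j)) \<in> A" unfolding pattern_in_def by auto
  then show "pattern_in k \<rho> A"
    unfolding pattern_in_def by (metis col_row row_less)
next
  assume "pattern_in k \<rho> A"
  then obtain r s where "strict_mono_on {..<k} r" "strict_mono_on {..<k} s"
    "\<forall>j<k. (r (\<rho> j), s j) \<in> A" unfolding pattern_in_def by auto
  then have "\<forall>j<k. (s (\<gamma> j), r j) \<in> A\<inverse>"
    by (metis row_col col_less converse_iff)
  then show "pattern_in k \<gamma> (A\<inverse>)"
    unfolding pattern_in_def using \<open>strict_mono_on {..<k} r\<close> \<open>strict_mono_on {..<k} s\<close> by blast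
qed

text \<open>A monotone map can only have increasing values at increasing arguments, so cells lying
  over a copy of the pattern are ordered like the copy. As each row and each column of the pattern
  has one entry, one cell per entry suffices. Contractions, translations and the wide-block argument
  are all instances.\<close>

lemma pattern_in_if_coarse:
  assumes r: "strict_mono_on {..<k} (r :: nat \<Rightarrow> nat)" and s: "strict_mono_on {..<k} (s :: nat \<Rightarrow> nat)"
    and g: "mono g" and h: "mono h"
    and A: "\<And>j. j < k \<Longrightarrow> \<exists>(x, y) \<in> A. g x = r (\<rho> j) \<and> h y = s j"
  shows "pattern_in k \<rho> A"
proof -
  from A have "\<forall>j. \<exists>x y. j < k \<longrightarrow> (x, y) \<in> A \<and> g x = r (\<rho> j) \<and> h y = s j" by fastforce
  then obtain X Y where XY: "\<And>j. j < k \<Longrightarrow> (X j, Y j) \<in> A \<and> g (X j) = r (\<rho> j) \<and> h (Y j) = s j"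
    by metis
  have "strict_mono_on {..<k} (X \<circ> \<gamma>)"
  proof (rule strict_mono_onI)
    fix i i' assume i: "i \<in> {..<k}" "i' \<in> {..<k}" "i < i'"
    then have "g (X (\<gamma> i)) < g (X (\<gamma> i'))"
      using XY[of "\<gamma> i"] XY[of "\<gamma> i'"] strict_mono_onD[OF r] by (simp add: col_less row_col)
    then show "(X \<circ> \<gamma>) i < (X \<circ> \<gamma>) i'"
      using g by (auto elim: mono_strict_invE)
  qed
  moreover have "strict_mono_on {..<k} Y"
  proof (rule strict_mono_onI)
    fix i i' assume i: "i \<in> {..<k}" "i' \<in> {..<k}" "i < i'"
    then have "h (Y i) < h (Y i')"
      using XY[of i] XY[of i'] strict_mono_onD[OF s] by simp
    then show "Y i < Y i'"
      using h by (auto elim: mono_strict_invE)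
  qed
  moreover have "\<forall>j<k. ((X \<circ> \<gamma>) (\<rho> j), Y j) \<in> A"
    using XY by (simp add: col_row)
  ultimately show ?thesis unfolding pattern_in_def by blast
qed

lemma pattern_in_contraction:
  assumes "pattern_in k \<rho> (block_of q ` A)"
  shows "pattern_in k \<rho> A"
proof -
  obtain r s where rs: "strict_mono_on {..<k} r" "strict_mono_on {..<k} s"
    "\<And>j. j < k \<Longrightarrow> (r (\<rho> j), s j) \<in> block_of q ` A"
    using assms unfolding pattern_in_def by auto
  show ?thesis
    by (rule pattern_in_if_coarse[OF rs(1,2) mono_div[of q] mono_div[of q]])
      (use rs(3) in \<open>fastforce simp: block_of_def\<close>)
qed

lemma contraction_avoiders:
  assumes "A \<in> avoiders k \<rho> n" "n \<le> q * m"
  shows "block_of q ` A \<in> avoiders k \<rho> m"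
proof -
  have "x div q < m" if "x < n" for x
    using that assms(2) by (intro less_mult_imp_div_less) (simp add: mult.commute)
  then show ?thesis
    using assms(1) pattern_in_contraction[of q A] by (fastforce simp: avoiders_def block_of_def)
qed

lemma empty_avoiders: "{} \<in> avoiders k \<rho> n"
  using k_ge_2 unfolding avoiders_def pattern_in_def by (auto intro: exI[of _ 0])

lemma ex_pattern_attained: obtains A where "A \<in> avoiders k \<rho> n" "card A = ex_pattern k \<rho> n"
proof -
  have "ex_pattern k \<rho> n \<in> card ` avoiders k \<rho> n"
    unfolding ex_pattern_def using empty_avoiders by (intro Max_in) auto
  then show ?thesis using that by auto
qed

lemma ex_pattern_mono: "m \<le> n \<Longrightarrow> ex_pattern k \<rho> m \<le> ex_pattern k \<rho> n"
proof -
  assume "m \<le> n"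
  obtain A where A: "A \<in> avoiders k \<rho> m" "card A = ex_pattern k \<rho> m" by (rule ex_pattern_attained)
  then have "A \<in> avoiders k \<rho> n" using \<open>m \<le> n\<close> unfolding avoiders_def by fastforce
  then show ?thesis using card_le_ex_pattern A(2) by metis
qed

lemma ex_pattern_one: "ex_pattern k \<rho> 1 = 1"
proof -
  have "\<not> pattern_in k \<rho> ({..<1} \<times> {..<1})"
  proof
    assume "pattern_in k \<rho> ({..<1} \<times> {..<1})"
    then obtain s where "strict_mono_on {..<k} s" "\<forall>j<k. s j = (0::nat)"
      unfolding pattern_in_def by auto
    then show False using strict_mono_onD[of "{..<k}" s 0 1] k_ge_2 by simp
  qed
  then have "{..<1} \<times> {..<1} \<in> avoiders k \<rho> 1" by (simp add: avoiders_def)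
  from card_le_ex_pattern[OF this] have "1 \<le> ex_pattern k \<rho> 1" by simp
  moreover obtain A where A: "A \<in> avoiders k \<rho> 1" "card A = ex_pattern k \<rho> 1"
    by (rule ex_pattern_attained)
  then have "card A \<le> card ({..<1::nat} \<times> {..<1::nat})"
    by (intro card_mono) (auto simp: avoiders_def)
  ultimately show ?thesis using A by simp
qed

section \<open>The Marcus-Tardos linear bound\<close>

text \<open>
  If \<open>k\<close> wide blocks of one block column had the same set of nonzero columns, the pattern could
  take its row \<open>i\<close> from the \<open>i\<close>-th of these blocks.
\<close>

lemma card_wide_blocks:
  fixes b :: nat
  assumes A: "finite A" "\<not> pattern_in k \<rho> A" and q: "q > 0"
  defines "W \<equiv> \<lambda>a. {y. \<exists>x. (x, y) \<in> A \<and> x div q = a \<and> y div q = b}"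
  shows "finite {a. k \<le> card (W a)}" "card {a. k \<le> card (W a)} \<le> k * 2 ^ q"
proof -
  let ?S = "{a. k \<le> card (W a)}"
  have finW: "finite (W a)" for a
    by (rule finite_subset[of _ "snd ` A"]) (use A in \<open>force simp: W_def\<close>)+
  have "?S \<subseteq> (\<lambda>(x, y). x div q) ` A"
  proof
    fix a assume "a \<in> ?S"
    then have "W a \<noteq> {}" using k_ge_2 by auto
    then show "a \<in> (\<lambda>(x, y). x div q) ` A" by (force simp: W_def)
  qed
  then show fin: "finite ?S" using A finite_subset by blast
  have "W a \<subseteq> {q * b..<q * b + q}" for a
    using block_subset[OF q, of a b] by (force simp: W_def block_of_def)
  \<comment> \<open>The nonzero columns of a block form one of the \<open>2 ^ q\<close> subsets of
    its column range, which sets up a pigeonhole argument over these subsets.\<close>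
  then have sub: "W ` ?S \<subseteq> Pow {q * b..<q * b + q}" by auto
  have fibre: "card {a \<in> ?S. W a = w} \<le> k" if "w \<in> W ` ?S" for w
  proof (rule ccontr)
    assume "\<not> ?thesis"
    then have "k \<le> card {a \<in> ?S. W a = w}" by simp
    moreover have "finite {a \<in> ?S. W a = w}" using fin by simp
    ultimately obtain r where r: "strict_mono_on {..<k} r" "r ` {..<k} \<subseteq> {a \<in> ?S. W a = w}"
      by (metis ex_strict_mono_on_into)
    have "finite w" "k \<le> card w" using that finW by auto
    then obtain s where s: "strict_mono_on {..<k} s" "s ` {..<k} \<subseteq> w"
      by (rule ex_strict_mono_on_into)
    have "pattern_in k \<rho> A"
    proof (rule pattern_in_if_coarse[OF r(1) s(1) mono_div[of q] mono_ident])
      fix j assume "j < k"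
      then have "s j \<in> W (r (\<rho> j))" using r(2) s(2) row_less by (auto simp: image_subset_iff)
      then show "\<exists>(x, y)\<in>A. x div q = r (\<rho> j) \<and> y = s j" by (fastforce simp: W_def)
    qed
    with A(2) show False by simp
  qed
  have "card ?S = (\<Sum>w \<in> W ` ?S. card {a \<in> ?S. W a = w})"
    using sum.image_gen[OF fin, of "\<lambda>_. 1::nat" W] by simp
  also have "\<dots> \<le> (\<Sum>w \<in> W ` ?S. k)" by (intro sum_mono fibre)
  also have "\<dots> \<le> k * 2 ^ q"
    using card_mono[OF _ sub] by (simp add: card_Pow)
  finally show "card ?S \<le> k * 2 ^ q" .
qed


text \<open>The Marcus-Tardos recursion. A nonempty block that is neither wide (\<open>W\<close>)
  nor tall (\<open>T\<close>) has fewer than \<open>k\<close> nonzero rows and columns, hence at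
  most \<open>(k - 1) ^ 2\<close> ones, and there are at most \<open>ex_pattern k \<rho> m\<close>
  such blocks. Wide and tall blocks number at most \<open>k * 2 ^ q\<close> per block column and
  block row, and each has at most \<open>q ^ 2\<close> ones.\<close>

lemma ex_pattern_blocks:
  assumes q: "q > 0"
  shows "ex_pattern k \<rho> (q * m) \<le> (k - 1)\<^sup>2 * ex_pattern k \<rho> m + 2 * q\<^sup>2 * k * 2 ^ q * m"
proof -
  obtain A where A: "A \<in> avoiders k \<rho> (q * m)" "card A = ex_pattern k \<rho> (q * m)"
    by (rule ex_pattern_attained)
  have fin: "finite A" using A(1) by (auto simp: avoiders_def intro: finite_subset)
  define B where "B = block_of q ` A"
  define F where "F b = {z \<in> A. block_of q z = b}" for b
  define W where "W = {b \<in> B. k \<le> card (snd ` F b)}"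
  define T where "T = {b \<in> B. k \<le> card (fst ` F b)}"
  have B: "B \<in> avoiders k \<rho> m" unfolding B_def using A(1) by (rule contraction_avoiders) simp
  have finB: "finite B" by (simp add: B_def fin)
  have finF: "finite (F b)" for b using fin by (simp add: F_def)
  have BW: "snd ` F (a, b) = {y. \<exists>x. (x, y) \<in> A \<and> x div q = a \<and> y div q = b}" for a b
    by (force simp: F_def block_of_def)
  have BT: "fst ` F (a, b) = {x. \<exists>y. (y, x) \<in> A\<inverse> \<and> y div q = b \<and> x div q = a}" for a b
    by (force simp: F_def block_of_def)
  have W: "card W \<le> m * (k * 2 ^ q)"
  proof -
    define G where "G b = {a. k \<le> card (snd ` F (a, b))}" for b
    have G: "finite (G b)" "card (G b) \<le> k * 2 ^ q" for b
      unfolding G_def BW using card_wide_blocks[OF fin _ q] A(1) by (auto simp: avoiders_def)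
    have "W \<subseteq> (\<Union>b<m. (\<lambda>a. (a, b)) ` G b)"
      using B by (auto simp: W_def G_def avoiders_def)
    then have "card W \<le> card (\<Union>b<m. (\<lambda>a. (a, b)) ` G b)"
      by (intro card_mono) (auto simp: G)
    also have "\<dots> \<le> (\<Sum>b<m. card ((\<lambda>a. (a, b)) ` G b))" by (rule card_UN_le) simp
    also have "\<dots> \<le> (\<Sum>b<m. k * 2 ^ q)"
      by (intro sum_mono order.trans[OF card_image_le]) (auto simp: G)
    finally show ?thesis by simp
  qed
  \<comment> \<open>Tall blocks of \<open>A\<close> are the wide blocks of its transpose, which
    avoids the inverse pattern.\<close>
  have T: "card T \<le> m * (k * 2 ^ q)"
  proof -
    define G where "G a = {b. k \<le> card (fst ` F (a, b))}" for a
    have G: "finite (G b)" "card (G b) \<le> k * 2 ^ q" for b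
      unfolding G_def BT using perm_pattern.card_wide_blocks[OF transpose _ _ q, of "A\<inverse>"] A(1) fin
      by (auto simp: avoiders_def pattern_in_converse)
    have "T \<subseteq> (\<Union>a<m. Pair a ` G a)"
      using B by (auto simp: T_def G_def avoiders_def)
    then have "card T \<le> card (\<Union>a<m. Pair a ` G a)"
      by (intro card_mono) (auto simp: G)
    also have "\<dots> \<le> (\<Sum>a<m. card (Pair a ` G a))" by (rule card_UN_le) simp
    also have "\<dots> \<le> (\<Sum>b<m. k * 2 ^ q)"
      by (intro sum_mono order.trans[OF card_image_le]) (auto simp: G)
    finally show ?thesis by simp
  qed
  have bound: "card (F b) \<le> (k - 1)\<^sup>2 + q\<^sup>2 * (of_bool (b \<in> W) + of_bool (b \<in> T))" if "b \<in> B" for b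
  proof (cases "b \<in> W \<or> b \<in> T")
    case True
    have "card (F b) \<le> q\<^sup>2 * 1" using card_block_le[OF q, of A b] by (simp add: F_def)
    also have "\<dots> \<le> q\<^sup>2 * (of_bool (b \<in> W) + of_bool (b \<in> T))"
      using True by (intro mult_left_mono) auto
    finally show ?thesis by simp
  next
    case False
    have "F b \<subseteq> fst ` F b \<times> snd ` F b" by force
    then have "card (F b) \<le> card (fst ` F b \<times> snd ` F b)"
      by (rule card_mono[rotated]) (simp add: finF)
    also have "\<dots> \<le> (k - 1) * (k - 1)"
      using False that unfolding card_cartesian_product by (intro mult_mono) (auto simp: W_def T_def)
    finally show ?thesis by (simp add: power2_eq_square)
  qed
  have "card A = (\<Sum>b\<in>B. card (F b))"
    using sum.image_gen[OF fin, of "\<lambda>_. 1::nat" "block_of q"] by (simp add: B_def F_def)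
  also have "\<dots> \<le> (\<Sum>b\<in>B. (k - 1)\<^sup>2 + q\<^sup>2 * (of_bool (b \<in> W) + of_bool (b \<in> T)))"
    by (intro sum_mono bound)
  also have "\<dots> = (k - 1)\<^sup>2 * card B + q\<^sup>2 * (card W + card T)"
    using finB by (simp add: sum.distrib sum_distrib_left[symmetric] Int_def W_def T_def)
  also have "\<dots> \<le> (k - 1)\<^sup>2 * ex_pattern k \<rho> m + q\<^sup>2 * (m * (k * 2 ^ q) + m * (k * 2 ^ q))"
    by (intro add_mono mult_left_mono W T card_le_ex_pattern B) auto
  finally show ?thesis using A(2) by (simp add: algebra_simps)
qed

text \<open>Since \<open>(k - 1) ^ 2 + 1 \<le> k ^ 2\<close>, block size \<open>q = k ^ 2\<close>
  makes the recursion close along the powers of \<open>q\<close> with constant \<open>D\<close>.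
  Rounding \<open>n\<close> up to a power of \<open>q\<close> costs one more factor
  \<open>q\<close>.\<close>

theorem marcus_tardos: "\<exists>K. \<forall>n. ex_pattern k \<rho> n \<le> K * n"
proof -
  define q where "q = k\<^sup>2"
  define D where "D = 2 * q\<^sup>2 * k * 2 ^ q"
  have q: "2 \<le> q" using k_ge_2 power_mono[OF k_ge_2, of 2] by (simp add: q_def)
  have D: "1 \<le> D" using k_ge_2 q by (simp add: D_def Suc_le_eq)
  have k: "(k - 1)\<^sup>2 + 1 \<le> q"
    using k_ge_2 by (cases k) (auto simp: q_def power2_eq_square)
  have pow: "ex_pattern k \<rho> (q ^ t) \<le> D * q ^ t" for t
  proof (induction t)
    case 0
    then show ?case using D ex_pattern_one by simp
  next
    case (Suc t)
    have "ex_pattern k \<rho> (q ^ Suc t) \<le> (k - 1)\<^sup>2 * ex_pattern k \<rho> (q ^ t) + D * q ^ t"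
      using ex_pattern_blocks[of q "q ^ t"] q by (simp add: D_def)
    also have "\<dots> \<le> (k - 1)\<^sup>2 * (D * q ^ t) + D * q ^ t"
      using Suc by (intro add_mono mult_left_mono) auto
    also have "\<dots> = ((k - 1)\<^sup>2 + 1) * (D * q ^ t)" by (simp add: algebra_simps)
    also have "\<dots> \<le> q * (D * q ^ t)" by (intro mult_right_mono k) simp
    finally show ?case by (simp add: algebra_simps)
  qed
  have "ex_pattern k \<rho> n \<le> (D * q) * n" for n
  proof (cases "n = 0")
    case True
    then show ?thesis using ex_pattern_attained[of 0] by (auto simp: avoiders_def)
  next
    case False
    then obtain t where t: "q ^ t \<le> n" "n < q ^ (t + 1)" using ex_power_ivl1[OF q, of n] by auto
    have "ex_pattern k \<rho> n \<le> ex_pattern k \<rho> (q ^ (t + 1))" using t by (intro ex_pattern_mono) simp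
    also have "\<dots> \<le> D * q ^ (t + 1)" by (rule pow)
    also have "\<dots> \<le> (D * q) * n" using t by simp
    finally show ?thesis .
  qed
  then show ?thesis by blast
qed


section \<open>Superadditivity of the extremal function\<close>

text \<open>The flag \<open>e\<close> distinguishes direct sums (\<open>True\<close>) from skew sums (\<open>False\<close>).\<close>

lemma pattern_in_split:
  assumes C: "pattern_in k \<rho> C"
    and split: "\<And>x y. (x, y) \<in> C \<Longrightarrow> (x < m) = ((y < n) = e)"
    and lower: "\<not> pattern_in k \<rho> {z \<in> C. fst z < m}"
    and upper: "\<not> pattern_in k \<rho> {z \<in> C. m \<le> fst z}"
  shows "\<exists>p q. 0 < p \<and> p < k \<and> (\<forall>j<k. (\<rho> j < p) = ((j < q) = e))"
proof -
  obtain r s where r: "strict_mono_on {..<k} r" and s: "strict_mono_on {..<k} s"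
    and rs: "\<And>j. j < k \<Longrightarrow> (r (\<rho> j), s j) \<in> C"
    using C unfolding pattern_in_def by auto
  have initial: "\<exists>p\<le>k. \<forall>i<k. (t i < l) = (i < p)" if t: "strict_mono_on {..<k} t" for t :: "nat \<Rightarrow> nat" and l
  proof -
    \<comment> \<open>The disjunct \<open>k \<le> i\<close> guarantees that the minimum exists and
      is at most \<open>k\<close>, even if all values lie below \<open>l\<close>.\<close>
    define p where "p = (LEAST i. k \<le> i \<or> l \<le> t i)"
    have p: "k \<le> p \<or> l \<le> t p" unfolding p_def by (rule LeastI[of _ k]) simp
    have p_le: "p \<le> i" if "k \<le> i \<or> l \<le> t i" for i unfolding p_def using that by (rule Least_le)
    have "(t i < l) = (i < p)" if "i < k" for i
    proof
      show "i < p" if "t i < l"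
      proof (rule ccontr)
        assume "\<not> i < p"
        then have "t p \<le> t i"
          using strict_mono_onD[OF t, of p i] \<open>i < k\<close> by (cases "p = i") auto
        with p that \<open>i < k\<close> \<open>\<not> i < p\<close> show False by simp
      qed
      show "t i < l" if "i < p"
        using p_le that by (meson not_le)
    qed
    then show ?thesis using p_le[of k] by blast
  qed
  obtain p where p: "p \<le> k" "\<And>i. i < k \<Longrightarrow> (r i < m) = (i < p)" using initial[OF r] by blast
  obtain q where q: "\<And>i. i < k \<Longrightarrow> (s i < n) = (i < q)" using initial[OF s] by blast
  \<comment> \<open>For \<open>p = 0\<close> the whole copy would use rows from \<open>m\<close> on,
    for \<open>p = k\<close> rows less than \<open>m\<close>; both are excluded, so the cut is
    proper.\<close>
  have "p \<noteq> 0"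
  proof
    assume "p = 0"
    then have "(r (\<rho> j), s j) \<in> {z \<in> C. m \<le> fst z}" if "j < k" for j
      using that rs p(2)[of "\<rho> j"] row_less by auto
    then show False using upper r s unfolding pattern_in_def by blast
  qed
  moreover have "p \<noteq> k"
  proof
    assume "p = k"
    then have "(r (\<rho> j), s j) \<in> {z \<in> C. fst z < m}" if "j < k" for j
      using that rs p(2)[of "\<rho> j"] row_less by auto
    then show False using lower r s unfolding pattern_in_def by blast
  qed
  moreover have "(\<rho> j < p) = ((j < q) = e)" if "j < k" for j
    using split[OF rs[OF that]] p(2)[of "\<rho> j"] q[OF that] row_less that by simp
  ultimately show ?thesis using p(1) by (metis le_neq_implies_less neq0_conv)
qed

text \<open>In a direct sum the column of row 0 is left of the column of row \<open>k - 1\<close>,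
  in a skew sum it is right of it. So at least one of the two kinds of cut is impossible, and
  \<open>e\<close> names it.\<close>

lemma indecomposable:
  obtains e where "\<And>p q. 0 < p \<Longrightarrow> p < k \<Longrightarrow> \<exists>j<k. (\<rho> j < p) \<noteq> ((j < q) = e)"
proof (cases "\<exists>p q. 0 < p \<and> p < k \<and> (\<forall>j<k. (\<rho> j < p) = (j < q))")
  case False
  then show ?thesis using that[of True] by auto
next
  case True
  then obtain p q where pq: "0 < p" "p < k" "\<And>j. j < k \<Longrightarrow> (\<rho> j < p) = (j < q)" by blast
  show ?thesis
  proof (rule that[of False], rule ccontr)
    fix p' q' assume p': "0 < p'" "p' < k" and "\<not> (\<exists>j<k. (\<rho> j < p') \<noteq> ((j < q') = False))"
    then have pq': "(\<rho> j < p') = (\<not> j < q')" if "j < k" for j using that by auto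
    have "0 < k" "k - 1 < k" using k_ge_2 by auto
    then show False
      using pq(1,2) p' pq(3)[of "\<gamma> 0"] pq(3)[of "\<gamma> (k - 1)"] pq'[of "\<gamma> 0"] pq'[of "\<gamma> (k - 1)"]
        col_less[of 0] col_less[of "k - 1"] row_col[of 0] row_col[of "k - 1"] by auto
  qed
qed

lemma pattern_in_translate:
  assumes "pattern_in k \<rho> ((\<lambda>(x, y). (u + x, v + y)) ` A)"
  shows "pattern_in k \<rho> A"
proof -
  obtain r s where rs: "strict_mono_on {..<k} r" "strict_mono_on {..<k} s"
    "\<And>j. j < k \<Longrightarrow> (r (\<rho> j), s j) \<in> (\<lambda>(x, y). (u + x, v + y)) ` A"
    using assms unfolding pattern_in_def by auto
  show ?thesis
    by (rule pattern_in_if_coarse[OF rs(1,2), of "(+) u" "(+) v"])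
      (use rs(3) in \<open>fastforce intro: monoI\<close>)+
qed

lemma ex_pattern_superadditive: "ex_pattern k \<rho> m + ex_pattern k \<rho> n \<le> ex_pattern k \<rho> (m + n)"
proof -
  obtain e where e: "\<And>p q. 0 < p \<Longrightarrow> p < k \<Longrightarrow> \<exists>j<k. (\<rho> j < p) \<noteq> ((j < q) = e)"
    using indecomposable by blast
  obtain A where A: "A \<in> avoiders k \<rho> m" "card A = ex_pattern k \<rho> m" by (rule ex_pattern_attained)
  obtain B where B: "B \<in> avoiders k \<rho> n" "card B = ex_pattern k \<rho> n" by (rule ex_pattern_attained)
  \<comment> \<open>\<open>A'\<close> takes the first \<open>m\<close> rows and \<open>B'\<close>
    the last \<open>n\<close>. The column shifts put \<open>A'\<close> to the left of
    \<open>B'\<close> if \<open>e\<close> holds and to the right otherwise, so a copy meeting both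
    would cut the pattern in the impossible way. The summand \<open>0 + x\<close> matches the form
    of \<open>pattern_in_translate\<close>.\<close>
  define A' where "A' = (\<lambda>(x, y). (0 + x, (if e then 0 else n) + y)) ` A"
  define B' where "B' = (\<lambda>(x, y). (m + x, (if e then m else 0) + y)) ` B"
  have sub: "A \<subseteq> {..<m} \<times> {..<m}" "B \<subseteq> {..<n} \<times> {..<n}" using A B by (auto simp: avoiders_def)
  then have fin: "finite A" "finite B" by (auto intro: finite_subset)
  have AB: "{z \<in> A' \<union> B'. fst z < m} = A'" "{z \<in> A' \<union> B'. m \<le> fst z} = B'"
    using sub by (auto simp: A'_def B'_def)
  have "\<not> pattern_in k \<rho> (A' \<union> B')"
  proof
    assume "pattern_in k \<rho> (A' \<union> B')"
    moreover have "(x < m) = ((y < (if e then m else n)) = e)" if "(x, y) \<in> A' \<union> B'" for x y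
      using that sub by (auto simp: A'_def B'_def)
    moreover have "\<not> pattern_in k \<rho> {z \<in> A' \<union> B'. fst z < m}" "\<not> pattern_in k \<rho> {z \<in> A' \<union> B'. m \<le> fst z}"
      unfolding AB unfolding A'_def B'_def using A(1) B(1) pattern_in_translate unfolding avoiders_def by blast+
    ultimately have "\<exists>p q. 0 < p \<and> p < k \<and> (\<forall>j<k. (\<rho> j < p) = ((j < q) = e))"
      by (rule pattern_in_split)
    then show False using e by metis
  qed
  moreover have "A' \<union> B' \<subseteq> {..<m + n} \<times> {..<m + n}"
    using sub by (auto simp: A'_def B'_def)
  ultimately have "A' \<union> B' \<in> avoiders k \<rho> (m + n)" by (simp add: avoiders_def)
  then have "card (A' \<union> B') \<le> ex_pattern k \<rho> (m + n)" by (rule card_le_ex_pattern)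
  moreover have "A' \<inter> B' = {}" using sub by (auto simp: A'_def B'_def)
  moreover have "card A' = card A" "card B' = card B"
    unfolding A'_def B'_def by (intro card_image; auto simp: inj_on_def)+
  ultimately show ?thesis using fin A(2) B(2) by (simp add: card_Un_disjoint A'_def B'_def)
qed

end

section \<open>Existence of the limit\<close>

text \<open>Fekete's lemma: the quotients converge to their supremum, which the linear bound makes
  finite, so each quotient is at most the limit.\<close>

lemma superadditive_le_lim:
  fixes f :: "nat \<Rightarrow> nat"
  assumes super: "\<And>m n. f m + f n \<le> f (m + n)" and linear: "\<And>n. f n \<le> K * n"
  shows "real (f n) \<le> lim (\<lambda>n. real (f n) / real n) * real n"
proof -
  define c where "c = (SUP n. real (f n) / real n)"
  have "real (f n) / real n \<le> real K" for n
    using linear[of n] by (cases "n = 0") (auto simp: divide_le_eq simp flip: of_nat_mult)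
  then have bdd: "bdd_above (range (\<lambda>n. real (f n) / real n))" by (intro bdd_aboveI2)
  have le: "real (f n) / real n \<le> c" for n
    unfolding c_def by (rule cSUP_upper[OF _ bdd]) simp
  have mult: "q * f d \<le> f (q * d)" for q d
  proof (induction q)
    case (Suc q)
    then show ?case using super[of d "q * d"] by simp
  qed simp
  have "(\<lambda>n. real (f n) / real n) \<longlonglongrightarrow> c"
  proof (rule order_tendstoI)
    fix a assume "c < a"
    then show "\<forall>\<^sub>F n in sequentially. real (f n) / real n < a"
      using le by (intro always_eventually) (meson le_less_trans)
  next
    fix a assume "a < c"
    then obtain d where d: "a < real (f d) / real d"
      using less_cSUP_iff[OF _ bdd] unfolding c_def by auto
    show "\<forall>\<^sub>F n in sequentially. a < real (f n) / real n"
    proof (cases "d = 0")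
      \<comment> \<open>Division by zero gives 0, so here \<open>a\<close> is negative and lies
        below all quotients.\<close>
      case True
      then have "a < real (f n) / real n" for n using d by (auto intro: less_le_trans)
      then show ?thesis by simp
    next
      case False
      define y where "y = real (f d) / real d"
      \<comment> \<open>Division with remainder by \<open>d\<close> gives
        \<open>n div d * f d \<le> f n\<close>, and \<open>n div d\<close> is at least
        \<open>(n - d) / d\<close>; the loss vanishes as \<open>n\<close> grows.\<close>
      have bound: "y - y * real d / real n \<le> real (f n) / real n" if "n > 0" for n
      proof -
        have "n div d * f d \<le> f n"
          using mult[of "n div d" d] super[of "n div d * d" "n mod d"] by simp
        then have "real (n div d) * real (f d) \<le> real (f n)" by (simp flip: of_nat_mult)
        moreover have "(real n - real d) / real d \<le> real (n div d)"
        proof -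
          have "n < d + n div d * d" using False by (intro dividend_less_div_times) simp
          then have "real n < real (d + n div d * d)" by (simp only: of_nat_less_iff)
          then have "real n < real d + real (n div d) * real d" by (simp only: of_nat_add of_nat_mult)
          then show ?thesis using False by (simp add: pos_divide_le_eq)
        qed
        then have "(real n - real d) / real d * real (f d) \<le> real (n div d) * real (f d)"
          by (rule mult_right_mono) simp
        ultimately have "(real n - real d) * y \<le> real (f n)" by (simp add: y_def)
        then have "(real n - real d) * y / real n \<le> real (f n) / real n" by (rule divide_right_mono) simp
        then show ?thesis using that by (simp add: field_simps)
      qed
      have "(\<lambda>n. y - y * real d / real n) \<longlonglongrightarrow> y - 0"
        by (intro tendsto_intros lim_const_over_n)
      then have "\<forall>\<^sub>F n in sequentially. a < y - y * real d / real n"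
        using d by (intro order_tendstoD) (auto simp: y_def)
      with eventually_gt_at_top[of 0] show ?thesis
        by eventually_elim (rule less_le_trans[OF _ bound])
    qed
  qed
  then have "lim (\<lambda>n. real (f n) / real n) = c" by (rule limI)
  moreover have "f 0 = 0" using linear[of 0] by simp
  ultimately show ?thesis using le[of n] by (cases "n = 0") (auto simp: divide_le_eq)
qed

section \<open>Counting avoiders through their contractions\<close>

text \<open>A set with image \<open>B\<close> is determined by its parts over the points of
  \<open>B\<close>, and each part is a nonempty subset of a fibre of at most \<open>s\<close>
  elements.\<close>

lemma card_sets_with_image:
  assumes "finite U" "finite B" and fibre: "\<And>b. b \<in> B \<Longrightarrow> card {x \<in> U. g x = b} \<le> s"
  shows "card {A. A \<subseteq> U \<and> g ` A = B} \<le> (2 ^ s - 1) ^ card B"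
proof -
  let ?R = "\<lambda>A. restrict (\<lambda>b. {x \<in> A. g x = b}) B"
  let ?P = "\<Pi>\<^sub>E b\<in>B. Pow {x \<in> U. g x = b} - {{}}"
  have "inj_on ?R {A. A \<subseteq> U \<and> g ` A = B}"
  proof (rule inj_onI)
    fix A A' assume A: "A \<in> {A. A \<subseteq> U \<and> g ` A = B}" "A' \<in> {A. A \<subseteq> U \<and> g ` A = B}" "?R A = ?R A'"
    have "{x \<in> A. g x = b} = {x \<in> A'. g x = b}" if "b \<in> B" for b
      using fun_cong[OF A(3), of b] that by simp
    with A(1,2) show "A = A'" by blast
  qed
  moreover have "?R ` {A. A \<subseteq> U \<and> g ` A = B} \<subseteq> ?P" by auto
  moreover have "finite ?P" using assms by (intro finite_PiE) auto
  ultimately have "card {A. A \<subseteq> U \<and> g ` A = B} \<le> card ?P" by (rule card_inj_on_le)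
  also have "\<dots> = (\<Prod>b\<in>B. card (Pow {x \<in> U. g x = b} - {{}}))" using assms by (intro card_PiE)
  also have "\<dots> \<le> (\<Prod>b\<in>B. 2 ^ s - 1)"
    using assms by (intro prod_mono) (auto simp: card_Diff_subset card_Pow diff_le_mono)
  finally show ?thesis by simp
qed

context perm_pattern
begin

text \<open>Each 1 of the contraction comes from a nonempty 2 by 2 block, for which there are
  \<open>2 ^ 4 - 1 = 15\<close> possibilities.\<close>

lemma card_avoiders_double:
  "card (avoiders k \<rho> (2 * m)) \<le> card (avoiders k \<rho> m) * 15 ^ ex_pattern k \<rho> m"
proof -
  let ?U = "{..<2 * m} \<times> {..<2 * m}"
  let ?F = "\<lambda>B. {A. A \<subseteq> ?U \<and> block_of 2 ` A = B}"
  have fin: "finite (?F B)" for B by (rule finite_subset[of _ "Pow ?U"]) auto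
  have "card (?F B) \<le> 15 ^ ex_pattern k \<rho> m" if B: "B \<in> avoiders k \<rho> m" for B
  proof -
    have "finite B" using B by (auto simp: avoiders_def intro: finite_subset)
    moreover have "card {z \<in> ?U. block_of 2 z = b} \<le> 4" for b
      using card_block_le[of 2 ?U b] by simp
    ultimately have "card (?F B) \<le> (2 ^ 4 - 1) ^ card B"
      by (intro card_sets_with_image finite_cartesian_product finite_lessThan)
    also have "\<dots> \<le> 15 ^ ex_pattern k \<rho> m"
      using card_le_ex_pattern[OF B] by (simp add: power_increasing)
    finally show ?thesis .
  qed
  then have "(\<Sum>B\<in>avoiders k \<rho> m. card (?F B)) \<le> card (avoiders k \<rho> m) * 15 ^ ex_pattern k \<rho> m"
    using sum_bounded_above[of "avoiders k \<rho> m" "\<lambda>B. card (?F B)"] by auto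
  moreover have "avoiders k \<rho> (2 * m) \<subseteq> (\<Union>B\<in>avoiders k \<rho> m. ?F B)"
    using contraction_avoiders[of _ "2 * m" 2 m] by (auto simp: avoiders_def)
  then have "card (avoiders k \<rho> (2 * m)) \<le> card (\<Union>B\<in>avoiders k \<rho> m. ?F B)"
    by (intro card_mono) (auto simp: fin)
  moreover have "card (\<Union>B\<in>avoiders k \<rho> m. ?F B) \<le> (\<Sum>B\<in>avoiders k \<rho> m. card (?F B))"
    by (rule card_UN_le) simp
  ultimately show ?thesis by linarith
qed

text \<open>Given the contraction \<open>B\<close>, the \<open>l\<close> ones are chosen among the
  positions in the blocks of \<open>B\<close>, at most \<open>q ^ 2\<close> in each. Blocks at the
  border may be cut off when \<open>n < q * m\<close>.\<close>

lemma card_avoiders_with_ones: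
  assumes "q > 0" "n \<le> q * m"
  shows "card {A \<in> avoiders k \<rho> n. card A = l}
           \<le> card (avoiders k \<rho> m) * ((ex_pattern k \<rho> m * q\<^sup>2) choose l)"
proof -
  let ?U = "\<lambda>B. {z \<in> {..<n} \<times> {..<n}. block_of q z \<in> B}"
  let ?F = "\<lambda>B. {A. A \<subseteq> ?U B \<and> card A = l}"
  have finU: "finite (?U B)" for B by (rule finite_subset[of _ "{..<n} \<times> {..<n}"]) auto
  have fin: "finite (?F B)" for B by (rule finite_subset[of _ "Pow (?U B)"]) (use finU in auto)
  have "card (?F B) \<le> (ex_pattern k \<rho> m * q\<^sup>2) choose l" if B: "B \<in> avoiders k \<rho> m" for B
  proof -
    have "finite B" using B by (auto simp: avoiders_def intro: finite_subset)
    have "?U B = (\<Union>b\<in>B. {z \<in> {..<n} \<times> {..<n}. block_of q z = b})" by auto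
    then have "card (?U B) \<le> (\<Sum>b\<in>B. card {z \<in> {..<n} \<times> {..<n}. block_of q z = b})"
      by (simp only: card_UN_le[OF \<open>finite B\<close>])
    also have "\<dots> \<le> card B * q\<^sup>2"
      using sum_mono[of B _ "\<lambda>_. q\<^sup>2", OF card_block_le[OF assms(1)]] by simp
    also have "\<dots> \<le> ex_pattern k \<rho> m * q\<^sup>2" by (intro mult_right_mono card_le_ex_pattern B) simp
    finally show ?thesis by (simp add: n_subsets[OF finU] binomial_right_mono)
  qed
  then have "(\<Sum>B\<in>avoiders k \<rho> m. card (?F B)) \<le> card (avoiders k \<rho> m) * ((ex_pattern k \<rho> m * q\<^sup>2) choose l)"
    using sum_bounded_above[of "avoiders k \<rho> m" "\<lambda>B. card (?F B)"] by auto
  moreover have "{A \<in> avoiders k \<rho> n. card A = l} \<subseteq> (\<Union>B\<in>avoiders k \<rho> m. ?F B)"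
  proof (intro subsetI UN_I)
    fix A assume A: "A \<in> {A \<in> avoiders k \<rho> n. card A = l}"
    then show "block_of q ` A \<in> avoiders k \<rho> m"
      by (intro contraction_avoiders[OF _ assms(2)]) simp
    show "A \<in> ?F (block_of q ` A)" using A by (auto simp: avoiders_def)
  qed
  then have "card {A \<in> avoiders k \<rho> n. card A = l} \<le> card (\<Union>B\<in>avoiders k \<rho> m. ?F B)"
    by (intro card_mono) (auto simp: fin)
  moreover have "card (\<Union>B\<in>avoiders k \<rho> m. ?F B) \<le> (\<Sum>B\<in>avoiders k \<rho> m. card (?F B))"
    by (rule card_UN_le) simp
  ultimately show ?thesis by linarith
qed

end

section \<open>A binomial estimate\<close>

text \<open>\<open>n ^ n / fact n\<close> is one term of the series of \<open>exp n\<close>, and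
  \<open>exp 1 \<le> 3\<close>.\<close>

lemma power_self_le_fact: "real n ^ n \<le> 3 ^ n * fact n"
proof -
  have "(\<Sum>i\<in>{n}. real n ^ i /\<^sub>R fact i) \<le> exp (real n)"
    unfolding exp_def by (rule sum_le_suminf) (auto simp: summable_exp)
  then have "real n ^ n \<le> exp (real n) * fact n"
    by (simp add: field_simps)
  also have "exp (real n) = exp 1 ^ n" by (simp flip: exp_of_nat_mult)
  also have "exp (1::real) ^ n * fact n \<le> 3 ^ n * fact n"
    by (intro mult_right_mono power_mono exp_le) auto
  finally show ?thesis .
qed

lemma binomial_le_power:
  assumes "real a \<le> y * real n"
  shows "real (a choose n) \<le> (3 * y) ^ n"
proof (cases "n = 0")
  case False
  have y: "0 \<le> y" using assms False by (smt (verit) mult_neg_pos of_nat_0_le_iff of_nat_0_less_iff neq0_conv)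
  have "real (a choose n) * fact n \<le> real a ^ n"
    using binomial_fact_pow[of a n] by (metis of_nat_fact of_nat_le_iff of_nat_mult of_nat_power)
  also have "\<dots> \<le> (y * real n) ^ n" using assms by (intro power_mono) auto
  also have "\<dots> = y ^ n * real n ^ n" by (rule power_mult_distrib)
  also have "\<dots> \<le> y ^ n * (3 ^ n * fact n)"
    using y by (intro mult_left_mono power_self_le_fact) simp
  also have "\<dots> = (3 * y) ^ n * fact n" by (simp add: power_mult_distrib)
  finally show ?thesis by simp
qed simp

section \<open>The count in terms of the limit\<close>

context perm_pattern
begin

definition c :: real where "c = lim (\<lambda>n. real (ex_pattern k \<rho> n) / real n)"

lemma ex_pattern_le_limit: "real (ex_pattern k \<rho> n) \<le> c * real n"
proof -
  obtain K where "\<And>n. ex_pattern k \<rho> n \<le> K * n" using marcus_tardos by blast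
  with ex_pattern_superadditive show ?thesis unfolding c_def by (rule superadditive_le_lim)
qed

lemma c_ge_1: "1 \<le> c"
  using ex_pattern_le_limit[of 1] ex_pattern_one by simp

text \<open>Each doubling contributes a factor of at most \<open>15 powr (c * 2 ^ t)\<close>, which
  doubles the exponent. At size 1 there are at most two matrices, and
  \<open>1 \<le> c\<close>.\<close>

lemma card_avoiders_pow2: "real (card (avoiders k \<rho> (2 ^ t))) \<le> 15 powr (c * 2 ^ t)"
proof (induction t)
  case 0
  have "card (avoiders k \<rho> 1) \<le> card (Pow ({..<1::nat} \<times> {..<1::nat}))"
    by (intro card_mono) (auto simp: avoiders_def)
  then have "real (card (avoiders k \<rho> 1)) \<le> 15 powr 1" by (simp add: card_Pow)
  also have "\<dots> \<le> 15 powr c" using c_ge_1 by (intro powr_mono) auto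
  finally show ?case by simp
next
  case (Suc t)
  have "real (card (avoiders k \<rho> (2 ^ Suc t)))
      \<le> real (card (avoiders k \<rho> (2 ^ t)) * 15 ^ ex_pattern k \<rho> (2 ^ t))"
    using card_avoiders_double[of "2 ^ t"] by (simp only: of_nat_le_iff power_Suc)
  also have "\<dots> = real (card (avoiders k \<rho> (2 ^ t))) * 15 powr real (ex_pattern k \<rho> (2 ^ t))"
    by (simp add: powr_realpow)
  also have "\<dots> \<le> 15 powr (c * 2 ^ t) * 15 powr (c * 2 ^ t)"
    using ex_pattern_le_limit[of "2 ^ t"] by (intro mult_mono Suc powr_mono) auto
  also have "\<dots> = 15 powr (c * 2 ^ Suc t)" by (simp add: mult_ac flip: powr_add)
  finally show ?case .
qed

text \<open>
  The number of blocks is a power of two \<open>m\<close> with \<open>n / (2 c) < m \<le> n / c\<close>: then there are at most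
  \<open>15 ^ n\<close> contractions, and a contraction leaves at most \<open>5 c\<^sup>2 n\<close> positions for the 1-entries.
\<close>

lemma card_avoiders_with_n_ones:
  "real (card {A \<in> avoiders k \<rho> n. card A = n}) \<le> (240 * c\<^sup>2) ^ n"
proof -
  have c2: "c \<le> c\<^sup>2" using c_ge_1 by (simp add: power2_eq_square)
  consider "n = 0" | "n > 0" "real n < c" | "n > 0" "c \<le> real n" by linarith
  then show ?thesis
  proof cases
    case 1
    have "card {A \<in> avoiders k \<rho> n. card A = n} \<le> card {{} :: (nat \<times> nat) set}"
      by (intro card_mono) (auto simp: avoiders_def 1)
    then show ?thesis by (simp add: 1)
  next
    case 2
    \<comment> \<open>No positive \<open>m\<close> satisfies \<open>m \<le> n / c\<close> here, so
      all choices of \<open>n\<close> positions are counted; \<open>n < c \<le> c ^ 2\<close> makes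
      this crude bound enough.\<close>
    let ?S = "{A. A \<subseteq> {..<n} \<times> {..<n} \<and> card A = n}"
    have "finite ?S" by (rule finite_subset[of _ "Pow ({..<n} \<times> {..<n})"]) auto
    then have "card {A \<in> avoiders k \<rho> n. card A = n} \<le> card ?S"
      by (rule card_mono) (auto simp: avoiders_def)
    also have "\<dots> = (n * n) choose n" by (simp add: n_subsets)
    finally have "real (card {A \<in> avoiders k \<rho> n. card A = n}) \<le> real ((n * n) choose n)"
      by (simp only: of_nat_le_iff)
    also have "\<dots> \<le> (3 * real n) ^ n" by (rule binomial_le_power) simp
    also have "\<dots> \<le> (240 * c\<^sup>2) ^ n" using 2 c2 by (intro power_mono) auto
    finally show ?thesis .
  next
    case 3
    have "1 \<le> real n / c" using 3 c_ge_1 by simp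
    then have "1 \<le> nat \<lfloor>real n / c\<rfloor>" by linarith
    then obtain t where t: "2 ^ t \<le> nat \<lfloor>real n / c\<rfloor>" "nat \<lfloor>real n / c\<rfloor> < 2 ^ (t + 1)"
      using ex_power_ivl1[of 2] by blast
    define m :: nat where "m = 2 ^ t"
    \<comment> \<open>The added 1 makes the blocks cover all of \<open>n\<close>, while
      \<open>q * m\<close> still stays within \<open>n + m\<close>.\<close>
    define q where "q = n div m + 1"
    have m: "0 < m" by (simp add: m_def)
    have "m \<le> nat \<lfloor>real n / c\<rfloor>" "nat \<lfloor>real n / c\<rfloor> + 1 \<le> 2 * m" using t by (auto simp: m_def)
    then have "real m \<le> real n / c" "real n / c < 2 * real m" by linarith+
    then have cm: "c * real m \<le> real n" "real n < 2 * c * real m"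
      using c_ge_1 by (auto simp: field_simps)
    have "1 * real m \<le> c * real m" using c_ge_1 by (intro mult_right_mono) auto
    then have "real m \<le> c * real m" by simp
    then have mn: "real m \<le> real n" using cm by linarith
    have nq: "n \<le> q * m"
      using dividend_less_div_times[of m n] m by (simp add: q_def)
    have "q * m \<le> n + m" using div_times_less_eq_dividend[of n m] by (simp add: q_def)
    then have qm: "real q * real m \<le> real n + real m" by (simp only: of_nat_le_iff flip: of_nat_add of_nat_mult)
    have "(real q * real m)\<^sup>2 \<le> (real n + real m)\<^sup>2" using qm by (intro power_mono) auto
    also have "\<dots> = real n * real n + 2 * (real n * real m) + real m * real m"
      by (simp add: power2_eq_square algebra_simps)
    \<comment> \<open>One factor \<open>n\<close> of the first term becomes
      \<open>2 * c * m\<close>. In the other two terms one \<open>m\<close> becomes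
      \<open>c * m\<close>, and in the last the remaining \<open>m\<close> becomes \<open>n\<close>.
      The coefficients add up to 5.\<close>
    also have "\<dots> \<le> real n * (2 * c * real m) + 2 * (real n * (c * real m)) + real n * (c * real m)"
      using cm mn \<open>real m \<le> c * real m\<close> by (intro add_mono mult_mono mult_left_mono) auto
    also have "\<dots> = 5 * c * real n * real m" by (simp add: algebra_simps)
    finally have "(real m * (real q)\<^sup>2) * real m \<le> (5 * c * real n) * real m"
      by (simp add: power2_eq_square algebra_simps)
    then have mq: "real m * (real q)\<^sup>2 \<le> 5 * c * real n"
      by (rule mult_right_le_imp_le) (use m in simp)
    have "real (ex_pattern k \<rho> m * q\<^sup>2) \<le> c * real m * (real q)\<^sup>2"
      using ex_pattern_le_limit[of m] by (simp add: mult_right_mono)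
    also have "\<dots> \<le> c * (5 * c * real n)"
      using mq c_ge_1 by (simp only: mult.assoc) (intro mult_left_mono; simp)
    finally have "real (ex_pattern k \<rho> m * q\<^sup>2) \<le> (5 * c\<^sup>2) * real n"
      by (simp add: power2_eq_square algebra_simps)
    then have choices: "real ((ex_pattern k \<rho> m * q\<^sup>2) choose n) \<le> (3 * (5 * c\<^sup>2)) ^ n"
      by (rule binomial_le_power)
    have "real (card (avoiders k \<rho> m)) \<le> 15 powr (c * real m)"
      using card_avoiders_pow2[of t] by (simp add: m_def)
    also have "\<dots> \<le> 15 powr real n" using cm by (intro powr_mono) auto
    finally have contractions: "real (card (avoiders k \<rho> m)) \<le> 15 ^ n" by (simp add: powr_realpow)
    have "real (card {A \<in> avoiders k \<rho> n. card A = n})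
        \<le> real (card (avoiders k \<rho> m) * ((ex_pattern k \<rho> m * q\<^sup>2) choose n))"
      using card_avoiders_with_ones[of q n m n] nq by (simp only: of_nat_le_iff) (simp add: q_def)
    also have "\<dots> \<le> 15 ^ n * (3 * (5 * c\<^sup>2)) ^ n"
      unfolding of_nat_mult by (intro mult_mono contractions choices) auto
    \<comment> \<open>The factor 15 comes from the contractions, 3 from the binomial estimate and 5
      from the number of positions; the product 225 is below 240.\<close>
    also have "\<dots> = (15 * (3 * (5 * c\<^sup>2))) ^ n" by (rule power_mult_distrib[symmetric])
    also have "\<dots> = (225 * c\<^sup>2) ^ n" by simp
    also have "\<dots> \<le> (240 * c\<^sup>2) ^ n" by (intro power_mono) auto
    finally show ?thesis .
  qed
qed

end

section \<open>Translation to matrices and permutation lists\<close>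

definition ones :: "bool mat \<Rightarrow> (nat \<times> nat) set" where
  "ones M = {(i, j). i < dim_row M \<and> j < dim_col M \<and> M $$ (i, j)}"

definition row_of :: "nat list \<Rightarrow> nat \<Rightarrow> nat" where
  "row_of \<pi> j = \<pi> ! j - 1"

lemma bij_betw_row_of:
  assumes "is_permutation \<pi>"
  shows "bij_betw (row_of \<pi>) {..<length \<pi>} {..<length \<pi>}"
    and "j < length \<pi> \<Longrightarrow> \<pi> ! j = row_of \<pi> j + 1"
proof -
  have \<pi>: "set \<pi> = {1..length \<pi>}" "distinct \<pi>"
    using assms by (auto simp: is_permutation_def dest: permutations_of_setD)
  have "bij_betw ((!) \<pi>) {..<length \<pi>} {1..length \<pi>}"
    using \<pi> by (intro bij_betw_nth) auto
  moreover have "bij_betw (\<lambda>x. x - 1) {1..length \<pi>} {..<length \<pi>}"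
    by (rule bij_betw_byWitness[where f' = Suc]) auto
  ultimately have "bij_betw ((\<lambda>x. x - 1) \<circ> (!) \<pi>) {..<length \<pi>} {..<length \<pi>}"
    by (rule bij_betw_trans)
  then show "bij_betw (row_of \<pi>) {..<length \<pi>} {..<length \<pi>}"
    by (simp add: row_of_def[abs_def] comp_def)
  show "\<pi> ! j = row_of \<pi> j + 1" if "j < length \<pi>"
    using nth_mem[OF that] \<pi>(1) by (simp add: row_of_def)
qed

text \<open>Exactly \<open>i\<close> elements of the image are smaller than \<open>r i\<close>, and
  \<open>pick\<close> recovers an element from this rank.\<close>

lemma pick_image_strict_mono:
  assumes r: "strict_mono_on {..<k} r" and i: "i < k"
  shows "pick (r ` {..<k}) i = r i"
proof -
  have less: "r a < r b \<longleftrightarrow> a < b" if "a < k" "b < k" for a b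
    using strict_mono_on_less[OF r] that by simp
  have "{x \<in> r ` {..<k}. x < r i} = r ` {..<i}" using less i by auto
  moreover have "inj_on r {..<i}"
    by (rule inj_on_subset[OF strict_mono_on_imp_inj_on[OF r]]) (use i in auto)
  ultimately have "card {x \<in> r ` {..<k}. x < r i} = i" by (simp add: card_image)
  then show ?thesis using pick_card_in_set[of "r i" "r ` {..<k}"] i by simp
qed

lemma pick_strict_mono_on:
  assumes "card {i. i < n \<and> i \<in> I} = k"
  shows "strict_mono_on {..<k} (pick I)"
proof (rule strict_mono_onI)
  fix a b assume ab: "a \<in> {..<k}" "b \<in> {..<k}" "a < b"
  \<comment> \<open>The index set of a submatrix may be infinite, and \<open>card I\<close> is then
    0.\<close>
  have "b < card I \<or> infinite I"
    using ab assms card_mono[of I "{i. i < n \<and> i \<in> I}"] by fastforce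
  then show "pick I a < pick I b" using ab(3) by (rule pick_mono)
qed

text \<open>The functions \<open>pick I\<close> and \<open>pick J\<close> enumerate the rows and
  columns of a submatrix and serve as \<open>r\<close> and \<open>s\<close>; conversely, the ranges
  of \<open>r\<close> and \<open>s\<close> serve as \<open>I\<close> and \<open>J\<close>.\<close>

lemma mat_contains_perm_matrix_iff:
  assumes \<pi>: "is_permutation \<pi>"
  shows "mat_contains M (perm_matrix \<pi>) \<longleftrightarrow> pattern_in (length \<pi>) (row_of \<pi>) (ones M)"
proof
  let ?k = "length \<pi>"
  have row_less: "row_of \<pi> j < ?k" if "j < ?k" for j
    using bij_betw_row_of(1)[OF \<pi>] that by (auto simp: bij_betw_def)
  show "pattern_in ?k (row_of \<pi>) (ones M)" if contains: "mat_contains M (perm_matrix \<pi>)"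
  proof -
    obtain I J where IJ: "card {i. i < dim_row M \<and> i \<in> I} = ?k" "card {j. j < dim_col M \<and> j \<in> J} = ?k"
      and le: "\<And>i j. i < ?k \<Longrightarrow> j < ?k \<Longrightarrow> \<pi> ! j = i + 1 \<Longrightarrow> submatrix M I J $$ (i, j)"
      using contains by (auto simp: mat_contains_def perm_matrix_def dim_submatrix)
    have "(pick I (row_of \<pi> j), pick J j) \<in> ones M" if "j < ?k" for j
    proof -
      have "submatrix M I J $$ (row_of \<pi> j, j)"
        using le[OF row_less that] bij_betw_row_of(2)[OF \<pi>] that by blast
      then have "M $$ (pick I (row_of \<pi> j), pick J j)"
        using submatrix_index[of "row_of \<pi> j" M I j J] row_less that IJ by simp
      moreover have "pick I (row_of \<pi> j) < dim_row M" "pick J j < dim_col M"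
        using row_less that IJ by (auto intro!: pick_le)
      ultimately show ?thesis by (simp add: ones_def)
    qed
    then show ?thesis
      using pick_strict_mono_on[OF IJ(1)] pick_strict_mono_on[OF IJ(2)] unfolding pattern_in_def by blast
  qed
  show "mat_contains M (perm_matrix \<pi>)" if "pattern_in ?k (row_of \<pi>) (ones M)"
  proof -
    obtain r s where r: "strict_mono_on {..<?k} r" and s: "strict_mono_on {..<?k} s"
      and rs: "\<And>j. j < ?k \<Longrightarrow> (r (row_of \<pi> j), s j) \<in> ones M"
      using \<open>pattern_in _ _ _\<close> unfolding pattern_in_def by auto
    define I J where "I = r ` {..<?k}" and "J = s ` {..<?k}"
    \<comment> \<open>Each row \<open>i\<close> of the pattern carries an entry, as
      \<open>row_of \<pi>\<close> is onto, so \<open>r i\<close> is the row of some 1 of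
      \<open>M\<close>.\<close>
    have "r i < dim_row M" if "i < ?k" for i
    proof -
      have "i \<in> row_of \<pi> ` {..<?k}" using bij_betw_row_of(1)[OF \<pi>] that by (simp add: bij_betw_def)
      then show ?thesis using rs by (auto simp: ones_def)
    qed
    then have "{i. i < dim_row M \<and> i \<in> I} = I" by (auto simp: I_def)
    then have I: "card {i. i < dim_row M \<and> i \<in> I} = ?k"
      using strict_mono_on_imp_inj_on[OF r] by (simp add: I_def card_image)
    have "{j. j < dim_col M \<and> j \<in> J} = J" using rs by (auto simp: J_def ones_def)
    then have J: "card {j. j < dim_col M \<and> j \<in> J} = ?k"
      using strict_mono_on_imp_inj_on[OF s] by (simp add: J_def card_image)
    have entries: "submatrix M I J $$ (i, j)" if "i < ?k" "j < ?k" "\<pi> ! j = i + 1" for i j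
    proof -
      have "i = row_of \<pi> j" using that by (simp add: row_of_def)
      then have "M $$ (r i, s j)" using rs[OF that(2)] by (simp add: ones_def)
      moreover have "pick I i = r i" "pick J j = s j"
        unfolding I_def J_def by (rule pick_image_strict_mono r s that)+
      ultimately show ?thesis using submatrix_index[of i M I j J] I J that by simp
    qed
    show ?thesis
      unfolding mat_contains_def
      by (rule exI[of _ I], rule exI[of _ J]) (use entries in \<open>simp add: perm_matrix_def dim_submatrix I J\<close>)
  qed
qed

lemma bij_betw_ones: "bij_betw ones (carrier_mat n n) (Pow ({..<n} \<times> {..<n}))"
  by (rule bij_betw_byWitness[where f' = "\<lambda>A. mat n n (\<lambda>z. z \<in> A)"]) (auto simp: ones_def)

lemma bij_betw_ones_avoiders:
  assumes "is_permutation \<pi>"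
  shows "bij_betw ones {M \<in> carrier_mat n n. avoids M \<pi>} (avoiders (length \<pi>) (row_of \<pi>) n)"
proof -
  have "avoiders (length \<pi>) (row_of \<pi>) n
      = {A \<in> Pow ({..<n} \<times> {..<n}). \<not> pattern_in (length \<pi>) (row_of \<pi>) A}"
    by (auto simp: avoiders_def)
  then show ?thesis
    unfolding avoids_def mat_contains_perm_matrix_iff[OF assms]
    by (simp only:) (rule bij_betw_Collect[OF bij_betw_ones], simp)
qed

lemma num_ones_eq_card_ones: "num_ones M = card (ones M)"
  by (simp add: num_ones_def ones_def)

lemma ex_perm_eq_ex_pattern:
  assumes "is_permutation \<pi>"
  shows "ex_perm \<pi> n = ex_pattern (length \<pi>) (row_of \<pi>) n"
  unfolding ex_perm_def ex_pattern_def bij_betw_imp_surj_on[OF bij_betw_ones_avoiders[OF assms], symmetric]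
  by (simp add: image_image num_ones_eq_card_ones)

lemma perm_pattern_row_of:
  assumes "is_permutation \<pi>" "2 \<le> length \<pi>"
  shows "perm_pattern (length \<pi>) (row_of \<pi>) (inv_into {..<length \<pi>} (row_of \<pi>))"
proof -
  note bij = bij_betw_row_of(1)[OF assms(1)]
  note bij' = bij_betw_inv_into[OF bij]
  show ?thesis
    using assms(2) bij_betwE[OF bij] bij_betwE[OF bij']
      bij_betw_inv_into_left[OF bij] bij_betw_inv_into_right[OF bij]
    by unfold_locales auto
qed

theorem theorem4p5:
  fixes \<pi> :: "nat list" and n :: nat
  assumes "is_permutation \<pi>"
  shows "real (card {M \<in> carrier_mat n n. avoids M \<pi> \<and> num_ones M = n})
           \<le> (240 * (fh_limit \<pi>)\<^sup>2) ^ n"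
proof -
  let ?k = "length \<pi>" and ?\<rho> = "row_of \<pi>"
  let ?S = "{M \<in> carrier_mat n n. avoids M \<pi> \<and> num_ones M = n}"
  let ?T = "{A \<in> avoiders ?k ?\<rho> n. card A = n}"
  have "bij_betw ones ?S ?T"
    using bij_betw_Collect[OF bij_betw_ones_avoiders[OF assms, of n], of "\<lambda>A. card A = n" "\<lambda>M. num_ones M = n"]
    by (simp add: num_ones_eq_card_ones conj_assoc)
  then have card: "card ?S = card ?T" by (rule bij_betw_same_card)
  show ?thesis
  proof (cases "2 \<le> ?k")
    case True
    interpret perm_pattern ?k ?\<rho> "inv_into {..<?k} ?\<rho>"
      using assms True by (rule perm_pattern_row_of)
    have "fh_limit \<pi> = c"
      by (simp add: fh_limit_def c_def ex_perm_eq_ex_pattern[OF assms])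
    then show ?thesis using card_avoiders_with_n_ones[of n] card by simp
  next
    case False
    \<comment> \<open>A pattern of length at most 1 occurs in every nonempty set, so at most the
      empty set is counted, and only for \<open>n = 0\<close>. The right side is then 1; otherwise
      nonnegativity is enough.\<close>
    have trivial: "pattern_in ?k ?\<rho> A" if "(x, y) \<in> A" for x y and A :: "(nat \<times> nat) set"
      unfolding pattern_in_def
      by (rule exI[of _ "\<lambda>_. x"], rule exI[of _ "\<lambda>_. y"])
        (use False that in \<open>auto simp: strict_mono_on_def\<close>)
    have "A = {}" if "A \<in> ?T" for A
    proof (rule ccontr)
      assume "A \<noteq> {}"
      then obtain x y where "(x, y) \<in> A" by auto
      then have "pattern_in ?k ?\<rho> A" by (rule trivial)
      with that show False by (simp add: avoiders_def)
    qed
    then have "?T \<subseteq> (if n = 0 then {{}} else {})" by force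
    then have "card ?T \<le> card (if n = 0 then {{}} else {} :: (nat \<times> nat) set set)"
      by (rule card_mono[rotated]) simp
    then have "real (card ?T) \<le> (if n = 0 then 1 else 0)" by (simp split: if_splits)
    also have "\<dots> \<le> (240 * (fh_limit \<pi>)\<^sup>2) ^ n" by simp
    finally show ?thesis using card by (simp only:)
  qed
qed

end
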